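(* Let $f:\mathbb{R}\to\mathbb{R}$ be continuous with $f(0)=0$ and $xf(x)>0$ for all $x\neq 0$. Suppose that there exists an odd function $\phi$ on $\mathbb{R}$ such that $\lim_{x\to 0} f(x)/\phi(x)=1$, that $f\in \mathrm{RV}_0(\beta)$ for some $\beta>1$, and that $\lim_{x\to 0^+} f(x)/x=0$. Let $\Gamma\in C([0,\infty);(0,\infty))$ satisfy $\lim_{t\to\infty}\Gamma(t)=+\infty$. Then there exists a continuous function $g:[0,\infty)\to\mathbb{R}$ which changes sign infinitely often, such that $\lim_{t\to\infty}\int_0^t g(s)\,ds$ exists and is finite, $$\lim_{t\to\infty}\frac{\int_t^\infty g(s)\,ds}{F^{-1}(t)}=0,\qquad \limsup_{t\to\infty}\frac{|g(t)|}{\Gamma(t)}=1,$$ and hence any continuous solution $x$ on $[0,\infty)$ of $$x'(t)=-f(x(t))+g(t),\quad t>0;\qquad x(0)=\xi\in\mathbb{R},$$ is such that there exists $\lambda\in\{-1,0,1\}$ with $\lim_{t\to\infty}x(t)/F^{-1}(t)=\lambda$.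
   Context: A function $f$ which is positive and measurable on $(0,\infty)$ is regularly varying at $0$ with index $\beta\in\mathbb{R}$, written $f\in\mathrm{RV}_0(\beta)$, if $\lim_{x\to0^+} f(\lambda x)/f(x)=\lambda^\beta$ for every $\lambda>0$ (for $f$ defined on $\mathbb{R}$ this refers to its restriction to $(0,\infty)$). Define $F(x)=\int_x^1 \frac{1}{f(u)}\,du$ for $x>0$. $F$ is strictly decreasing; since $\beta>1$, $F(x)\to\infty$ as $x\to0^+$. $F^{-1}$ denotes the inverse function of $F$; $F^{-1}(t)>0$ is defined for all $t\ge 0$ and tends to $0$ as $t\to\infty$. When $\lim_{T\to\infty}\int_0^T g(s)\,ds$ exists and is finite, $\int_t^\infty g(s)\,ds:=\lim_{T\to\infty}\int_0^T g(s)\,ds-\int_0^t g(s)\,ds$ (no absolute integrability is assumed). *)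

theory Defs
  imports "HOL-Analysis.Analysis"
begin

text \<open>Lebesgue measurability on the open half-line is the usual convention in the theory of
  regular variation.\<close>

definition RV0 :: "real \<Rightarrow> (real \<Rightarrow> real) \<Rightarrow> bool" where
  "RV0 \<beta> f \<longleftrightarrow>
     (\<forall>x>0. f x > 0) \<and>
     f \<in> borel_measurable (lebesgue_on {0<..}) \<and>
     (\<forall>l>0. ((\<lambda>x. f (l * x) / f x) \<longlongrightarrow> l powr \<beta>) (at_right 0))"

text \<open>The interval integral is oriented, so the value is negative for arguments above 1.\<close>

definition F_of :: "(real \<Rightarrow> real) \<Rightarrow> real \<Rightarrow> real" where
  "F_of f x = (LBINT u=x..1. 1 / f u)"

text \<open>The inverse is meaningful only at values attained on the open half-line.\<close>

definition F_inv :: "(real \<Rightarrow> real) \<Rightarrow> real \<Rightarrow> real" where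
  "F_inv f = the_inv_into {0<..} (F_of f)"

definition has_improper_integral :: "(real \<Rightarrow> real) \<Rightarrow> bool" where
  "has_improper_integral g \<longleftrightarrow> (\<exists>L. ((\<lambda>T. integral {0..T} g) \<longlongrightarrow> L) at_top)"

text \<open>A conditionally convergent tail; meaningful only under \<^const>\<open>has_improper_integral\<close>.\<close>

definition tail_integral :: "(real \<Rightarrow> real) \<Rightarrow> real \<Rightarrow> real" where
  "tail_integral g t = Lim at_top (\<lambda>T. integral {0..T} g) - integral {0..t} g"

text \<open>Sign changes occur at arbitrarily large times; merely infinitely many sign changes
  accumulating at a finite time do not count.\<close>

definition changes_sign_infinitely_often :: "(real \<Rightarrow> real) \<Rightarrow> bool" where
  "changes_sign_infinitely_often g \<longleftrightarrow> (\<forall>T\<ge>0. (\<exists>s\<ge>T. g s > 0) \<and> (\<exists>t\<ge>T. g t < 0))"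

definition is_solution ::
  "(real \<Rightarrow> real) \<Rightarrow> (real \<Rightarrow> real) \<Rightarrow> real \<Rightarrow> (real \<Rightarrow> real) \<Rightarrow> bool" where
  "is_solution f g \<xi> x \<longleftrightarrow>
     continuous_on {0..} x \<and> x 0 = \<xi> \<and>
     (\<forall>t>0. (x has_real_derivative (- f (x t) + g t)) (at t))"

end

theory Submission
  imports Defs
begin

text \<open>
  Write \<open>F\<close> for \<^term>\<open>F_of f\<close>. Along a positive solution,
  \<open>(F (x t))' = - x' t / f (x t) = 1 - g t / f (x t)\<close>. Hence \<open>F (x t) = t + O(1)\<close>, and so
  \<open>x t \<sim> F_inv f t\<close>, as soon as \<open>\<integral> \<bar>g\<bar> / f (x)\<close> is finite. A large value of \<open>\<bar>g\<bar>\<close> does no harm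
  if it is taken only on a very short time interval: thus \<open>g\<close> is built from spikes that reach \<open>\<Gamma>\<close>
  with alternating sign at the times \<open>n + 1/2\<close>, and are so thin that \<open>\<integral> \<bar>g\<bar> * M\<close> converges
  for a weight \<open>M\<close> given beforehand (\<open>alternating_spikes\<close>).

  The weight has to dominate \<open>1 / f (x t)\<close> for every relevant solution, although \<open>g\<close> must not
  depend on the solution. This is where a barrier comes in. Let \<open>M t\<close> dominate \<open>1 / f u\<close> for all
  \<open>u\<close> between \<open>F_inv f (t\<^sup>2 + 1)\<close> and \<open>t\<close>. The barrier \<open>F_inv f (t\<^sup>2 + 1)\<close> decays much faster than
  unperturbed solutions do, since \<open>F\<close> grows at speed at least 2 along it but at speed 1 along them.
  A solution that once exceeds \<open>F_inv f (a\<^sup>2)\<close> at a late time \<open>a\<close> therefore never meets the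
  barrier again (\<open>persistence\<close>): up to the first meeting the drift is at most 1, and with so
  little drift the meeting is impossible. Such a solution is asymptotic to \<open>F_inv f\<close>.

  The function \<open>k u = - f (- u)\<close> governs \<open>- x\<close>. Because \<open>f\<close> is asymptotically odd, \<open>k u / f u\<close>
  tends to 1 at zero, whence \<open>F_of k\<close> and \<open>F_of f\<close> are equivalent there, and the same argument for
  \<open>- x\<close> gives the limit \<open>-1\<close>. If neither alternative ever occurs late, then \<open>x t\<close> lies between
  \<open>- F_inv k (t\<^sup>2)\<close> and \<open>F_inv f (t\<^sup>2)\<close>, which are both negligible compared with \<open>F_inv f t\<close>, and
  the limit is 0.

  Regular variation serves only to invert asymptotic relations: by l'Hopital's rule \<open>F\<close> is
  regularly varying at zero with the negative index \<open>1 - \<beta>\<close>, so that \<open>F (y t) / t \<rightarrow> 1\<close> implies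
  \<open>y t / F_inv f t \<rightarrow> 1\<close>, and \<open>F (y t) / t \<rightarrow> \<infinity>\<close> implies \<open>y t / F_inv f t \<rightarrow> 0\<close>. Finally, if \<open>M\<close>
  also dominates \<open>1 / F_inv f\<close>, then the tail integral of \<open>g\<close> is at most \<open>F_inv f t\<close> times the tail of
  the convergent integral of \<open>\<bar>g\<bar> * M\<close>.
\<close>

section \<open>Integrals and limits on the half-line\<close>

lemma bounded_mono_tendsto_at_top:
  fixes W :: "real \<Rightarrow> real"
  assumes mono: "mono W" and bdd: "\<And>t. W t \<le> C"
  shows "\<exists>L. (W \<longlongrightarrow> L) at_top \<and> (\<forall>t. W t \<le> L)"
proof -
  have bd: "bdd_above (range W)" using bdd by (auto intro!: bdd_aboveI)
  have up: "W t \<le> Sup (range W)" for t by (rule cSup_upper[OF _ bd]) simp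
  have "(W \<longlongrightarrow> Sup (range W)) at_top"
  proof (rule increasing_tendsto)
    fix l assume "l < Sup (range W)"
    then obtain s where "l < W s" using less_cSup_iff[OF _ bd] by auto
    then show "eventually (\<lambda>t. l < W t) at_top"
      using mono by (intro eventually_at_top_linorderI[of s]) (auto dest: monoD intro: less_le_trans)
  qed (simp add: up)
  with up show ?thesis by blast
qed

lemma mono_integral_from_0:
  fixes q :: "real \<Rightarrow> real"
  assumes "continuous_on {0..} q" "\<And>t. t \<ge> 0 \<Longrightarrow> q t \<ge> 0"
  shows "mono (\<lambda>t. integral {0..t} q)"
proof (rule monoI)
  fix s t :: real assume "s \<le> t"
  then show "integral {0..s} q \<le> integral {0..t} q"
    using assms by (intro integral_subset_le integrable_continuous_real continuous_on_subset[OF assms(1)]) auto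
qed

text \<open>The integrals of \<open>\<bar>g\<bar>\<close> and of \<open>\<bar>g\<bar> + g\<close> are both monotone and bounded, and \<open>g\<close> is the difference of
  the integrands.\<close>

lemma convergent_integral_of_absolutely_bounded:
  fixes g :: "real \<Rightarrow> real"
  assumes cg: "continuous_on {0..} g"
    and bdd: "\<And>t. integral {0..t} (\<lambda>s. \<bar>g s\<bar>) \<le> C"
  shows "\<exists>L. ((\<lambda>T. integral {0..T} g) \<longlongrightarrow> L) at_top"
proof -
  have ig: "g integrable_on {0..t}" and iag: "(\<lambda>s. \<bar>g s\<bar>) integrable_on {0..t}" for t
    by (auto intro!: integrable_continuous_real continuous_intros continuous_on_subset[OF cg])
  define A where "A = (\<lambda>T. integral {0..T} (\<lambda>s. \<bar>g s\<bar>))"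
  define P where "P = (\<lambda>T. integral {0..T} (\<lambda>s. \<bar>g s\<bar> + g s))"
  have "mono A" unfolding A_def by (intro mono_integral_from_0 continuous_intros cg) auto
  then obtain LA where LA: "(A \<longlongrightarrow> LA) at_top"
    using bounded_mono_tendsto_at_top[of A C] bdd by (auto simp: A_def)
  have "P t \<le> 2 * A t" for t
  proof -
    have "P t \<le> integral {0..t} (\<lambda>s. 2 * \<bar>g s\<bar>)"
      unfolding P_def by (intro integral_le integrable_add iag ig integrable_on_mult_right) auto
    then show ?thesis by (simp add: A_def)
  qed
  then have "P t \<le> 2 * C" for t using bdd[of t] by (smt (verit) A_def)
  moreover have "mono P" unfolding P_def by (intro mono_integral_from_0 continuous_intros cg) auto
  ultimately obtain LP where LP: "(P \<longlongrightarrow> LP) at_top"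
    using bounded_mono_tendsto_at_top[of P "2 * C"] by auto
  have "(\<lambda>T. integral {0..T} g) = (\<lambda>T. P T - A T)"
    unfolding P_def A_def by (intro ext, subst integral_add[OF iag ig], simp)
  then show ?thesis using tendsto_diff[OF LP LA] by auto
qed

lemma tail_integral_abs_le:
  fixes g q :: "real \<Rightarrow> real"
  assumes cg: "continuous_on {0..} g" and cq: "continuous_on {0..} q"
    and imp: "has_improper_integral g" and t: "t \<ge> 0"
    and le: "\<And>s. t \<le> s \<Longrightarrow> \<bar>g s\<bar> \<le> r * q s" and r: "r \<ge> 0"
    and bdd: "\<And>T. integral {0..T} q \<le> L"
  shows "\<bar>tail_integral g t\<bar> \<le> r * (L - integral {0..t} q)"
proof -
  obtain I where I: "((\<lambda>T. integral {0..T} g) \<longlongrightarrow> I) at_top"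
    using imp unfolding has_improper_integral_def by blast
  then have "tail_integral g t = I - integral {0..t} g"
    unfolding tail_integral_def by (simp add: tendsto_Lim)
  moreover have "((\<lambda>T. \<bar>integral {0..T} g - integral {0..t} g\<bar>) \<longlongrightarrow> \<bar>I - integral {0..t} g\<bar>) at_top"
    by (intro tendsto_intros I)
  moreover have "\<bar>integral {0..T} g - integral {0..t} g\<bar> \<le> r * (L - integral {0..t} q)" if "t \<le> T" for T
  proof -
    have i: "f integrable_on {a..b}" if "continuous_on {0..} f" "a \<ge> 0" for f :: "real \<Rightarrow> real" and a b
      using that by (intro integrable_continuous_real continuous_on_subset[OF that(1)]) auto
    have comb: "integral {0..T} f = integral {0..t} f + integral {t..T} f"
      if "continuous_on {0..} f" for f :: "real \<Rightarrow> real"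
      using i[OF that] t \<open>t \<le> T\<close> by (intro Henstock_Kurzweil_Integration.integral_combine[symmetric]) auto
    have "\<bar>integral {t..T} g\<bar> \<le> integral {t..T} (\<lambda>s. r * q s)"
      using integral_norm_bound_integral[of g "{t..T}" "\<lambda>s. r * q s"] i[OF cg t] i[OF cq t] le
      by (auto intro: integrable_on_mult_right)
    also have "\<dots> = r * (integral {0..T} q - integral {0..t} q)" using comb[OF cq] by simp
    also have "\<dots> \<le> r * (L - integral {0..t} q)" using bdd[of T] r by (intro mult_left_mono) auto
    finally show ?thesis using comb[OF cg] by simp
  qed
  ultimately show ?thesis
    by (intro tendsto_upperbound[where F = at_top]) (auto intro: eventually_at_top_linorderI[of t])
qed

section \<open>Locally finite sums of bumps\<close>

text \<open>Only the functions with index below \<open>t\<close> can be nonzero at \<open>t\<close>. To the left of any integer \<open>N\<close> the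
  sum therefore agrees with the fixed finite sum over \<open>n < N\<close>.\<close>

lemma locally_finite_sum_continuous:
  fixes u :: "nat \<Rightarrow> real \<Rightarrow> real"
  assumes cont: "\<And>n. continuous_on UNIV (u n)"
    and supp: "\<And>n t. t \<le> real n \<Longrightarrow> u n t = 0"
  shows "continuous_on UNIV (\<lambda>t. \<Sum>n<nat \<lceil>t\<rceil>. u n t)"
proof (intro continuous_at_imp_continuous_on ballI)
  fix t0 :: real
  define N where "N = nat \<lceil>t0\<rceil> + 1"
  have eq: "(\<Sum>n<nat \<lceil>t\<rceil>. u n t) = (\<Sum>n<N. u n t)" if "t < real N" for t
  proof (rule sum.mono_neutral_left)
    show "{..<nat \<lceil>t\<rceil>} \<subseteq> {..<N}" using that by (auto simp: less_ceiling_iff zless_nat_eq_int_zless)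
    show "\<forall>n\<in>{..<N} - {..<nat \<lceil>t\<rceil>}. u n t = 0"
      using supp by (auto simp: not_less nat_le_iff ceiling_le_iff)
  qed simp
  have "t0 < real N" unfolding N_def by linarith
  then have "eventually (\<lambda>t. t < real N) (nhds t0)"
    by (intro eventually_nhds_in_open[of "{..<real N}", simplified]) auto
  then have "eventually (\<lambda>t. (\<Sum>n<nat \<lceil>t\<rceil>. u n t) = (\<Sum>n<N. u n t)) (nhds t0)"
    by eventually_elim (rule eq)
  then have "isCont (\<lambda>t. \<Sum>n<nat \<lceil>t\<rceil>. u n t) t0 \<longleftrightarrow> isCont (\<lambda>t. \<Sum>n<N. u n t) t0"
    by (rule isCont_cong)
  then show "isCont (\<lambda>t. \<Sum>n<nat \<lceil>t\<rceil>. u n t) t0"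
    using cont by (auto simp: continuous_on_eq_continuous_at intro!: continuous_intros)
qed

text \<open>Ramps starting at the integers are stacked up: on \<open>[n + 1, n + 2]\<close> the \<open>n\<close>th ramp has already risen
  to the bound valid there. Describing the quantities to be dominated by a relation \<open>P\<close> lets one
  majorant serve several families at once, without measurability or continuity of their suprema.\<close>

lemma continuous_majorant:
  fixes P :: "real \<Rightarrow> real \<Rightarrow> bool"
  assumes bdd: "\<And>n::nat. \<exists>c. \<forall>t\<in>{real n..real n + 1}. \<forall>v. P t v \<longrightarrow> v \<le> c"
  shows "\<exists>K. continuous_on UNIV K \<and> (\<forall>t\<ge>0. \<forall>v. P t v \<longrightarrow> v \<le> K t)"
proof -
  obtain c where c: "\<And>n t v. t \<in> {real n..real n + 1} \<Longrightarrow> P t v \<Longrightarrow> v \<le> c n"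
    using bdd by metis
  define u where "u = (\<lambda>n t. \<bar>c (Suc n)\<bar> * max 0 (t - real n))"
  define K where "K = (\<lambda>t. \<bar>c 0\<bar> + (\<Sum>n<nat \<lceil>t\<rceil>. u n t))"
  have "continuous_on UNIV K"
    unfolding K_def
    by (intro continuous_on_add continuous_on_const locally_finite_sum_continuous)
       (auto simp: u_def intro!: continuous_intros)
  moreover have "v \<le> K t" if "t \<ge> 0" "P t v" for t v
  proof -
    have u0: "u n t \<ge> 0" for n by (simp add: u_def)
    define n where "n = nat \<lfloor>t\<rfloor>"
    have n: "real n \<le> t" "t < real n + 1" using that(1) unfolding n_def by linarith+
    have v: "v \<le> \<bar>c n\<bar>" using c[of t n v] n that(2) by force
    show ?thesis
    proof (cases n)
      case 0
      then show ?thesis using v u0 by (simp add: K_def sum_nonneg add_increasing2)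
    next
      case (Suc m)
      have "\<bar>c n\<bar> * 1 \<le> u m t" unfolding u_def Suc
        using n Suc by (intro mult_left_mono) auto
      also have "\<dots> \<le> (\<Sum>n<nat \<lceil>t\<rceil>. u n t)"
        using n Suc u0 by (intro member_le_sum) (auto simp: less_ceiling_iff zless_nat_eq_int_zless)
      finally show ?thesis using v by (simp add: K_def)
    qed
  qed
  ultimately show ?thesis by blast
qed

definition spike :: "real \<Rightarrow> real \<Rightarrow> real \<Rightarrow> real" where
  "spike a c t = max 0 (1 - a * \<bar>t - c\<bar>)"

text \<open>The spike is at most the indicator of an interval of length \<open>2 / a\<close>, which lies inside \<open>[b, b + 1]\<close>
  because \<open>a \<ge> 2\<close>.\<close>

lemma spike_integral_le:
  fixes M :: "real \<Rightarrow> real"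
  assumes a: "a \<ge> 2" and C: "\<And>t. t \<in> {b..b+1} \<Longrightarrow> 0 \<le> M t \<and> M t \<le> C"
    and M: "continuous_on {b..b+1} M"
  shows "integral {b..b+1} (\<lambda>t. M t * spike a (b + 1/2) t) \<le> 2 * C / a"
proof -
  define l r where "l = b + 1/2 - 1/a" and "r = b + 1/2 + 1/a"
  have a': "1/a \<le> 1/2" "a > 0" using a by (auto simp: field_simps)
  have lr: "b \<le> l" "l \<le> r" "r \<le> b + 1" "r - l = 2 / a"
    using a' unfolding l_def r_def by (linarith, simp, linarith, simp)
  have "((\<lambda>_. C) has_integral (r - l) *\<^sub>R C) {l..r}"
    using has_integral_const_real[of C l r] lr by simp
  then have I: "((\<lambda>t. if t \<in> {l..r} then C else 0) has_integral (r - l) * C) {b..b+1}"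
    using lr by (subst has_integral_restrict) auto
  have "integral {b..b+1} (\<lambda>t. M t * spike a (b + 1/2) t)
      \<le> integral {b..b+1} (\<lambda>t. if t \<in> {l..r} then C else 0)"
  proof (rule integral_le)
    show "(\<lambda>t. M t * spike a (b + 1/2) t) integrable_on {b..b+1}"
      unfolding spike_def by (intro integrable_continuous_real continuous_intros M)
    show "(\<lambda>t. if t \<in> {l..r} then C else 0) integrable_on {b..b+1}"
      using I by (rule has_integral_integrable)
    fix t assume t: "t \<in> {b..b+1}"
    show "M t * spike a (b + 1/2) t \<le> (if t \<in> {l..r} then C else 0)"
    proof (cases "t \<in> {l..r}")
      case True
      have "spike a (b + 1/2) t \<le> 1" "0 \<le> spike a (b + 1/2) t" using a' by (auto simp: spike_def)
      then have "M t * spike a (b + 1/2) t \<le> C * 1" using C[OF t] by (intro mult_mono) auto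
      with True show ?thesis by simp
    next
      case False
      then have "1 / a \<le> \<bar>t - (b + 1/2)\<bar>" by (auto simp: l_def r_def)
      then have "1 \<le> a * \<bar>t - (b + 1/2)\<bar>" using a' by (simp add: field_simps)
      then have "spike a (b + 1/2) t = 0" by (simp add: spike_def)
      then show ?thesis unfolding if_not_P[OF False] by simp
    qed
  qed
  also have "\<dots> = 2 * C / a" using I lr by (simp add: integral_unique)
  finally show ?thesis .
qed

text \<open>On \<open>[n, n + 1]\<close> the function is \<open>\<Gamma>\<close> times a single spike of height 1 and sign \<open>(-1) ^ n\<close>, whose
  steepness is chosen so large that the weighted integral over this interval is at most
  \<open>(1/2) ^ n\<close>. The spikes vanish at the integers, so they fit together continuously.\<close>

lemma alternating_spikes:
  fixes \<Gamma> K :: "real \<Rightarrow> real"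
  assumes cG: "continuous_on {0..} \<Gamma>" and G: "\<And>t. t \<ge> 0 \<Longrightarrow> \<Gamma> t > 0"
    and cK: "continuous_on {0..} K" and K: "\<And>t. t \<ge> 0 \<Longrightarrow> K t \<ge> 0"
  shows "\<exists>g. continuous_on {0..} g \<and> (\<forall>t\<ge>0. \<bar>g t\<bar> \<le> \<Gamma> t) \<and>
    (\<forall>n::nat. g (real n + 1/2) = (-1) ^ n * \<Gamma> (real n + 1/2)) \<and>
    (\<forall>t. integral {0..t} (\<lambda>s. \<bar>g s\<bar> * K s) \<le> 2)"
proof -
  define M where "M = (\<lambda>t. \<Gamma> t * K t)"
  have cM: "continuous_on {0..} M" unfolding M_def by (intro continuous_intros cG cK)
  have M0: "t \<ge> 0 \<Longrightarrow> M t \<ge> 0" for t using G[of t] K[of t] by (simp add: M_def)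
  have "\<exists>c\<ge>0. \<forall>t\<in>{real n..real n+1}. M t \<le> c" for n
  proof -
    have "compact (M ` {real n..real n+1})"
      by (intro compact_continuous_image continuous_on_subset[OF cM]) auto
    then obtain B where "\<forall>y\<in>M ` {real n..real n+1}. norm y \<le> B"
      using compact_imp_bounded bounded_iff by metis
    then show ?thesis by (intro exI[of _ "\<bar>B\<bar>"]) (auto simp: abs_le_iff)
  qed
  then obtain c where c: "\<And>n. c n \<ge> 0" "\<And>n t. t \<in> {real n..real n+1} \<Longrightarrow> M t \<le> c n" by metis
  (* steepness 2 keeps the spike inside its unit interval, the other term makes it thin *)
  define a where "a = (\<lambda>n. max 2 (2 * c n * 2 ^ n))"
  define u where "u = (\<lambda>n t. (-1::real) ^ n * spike (a n) (real n + 1/2) t)"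
  have a2: "a n \<ge> 2" for n by (simp add: a_def)
  have far: "spike (a n) (real n + 1/2) t = 0" if "\<bar>t - (real n + 1/2)\<bar> \<ge> 1/2" for n t
  proof -
    have "2 * (1/2) \<le> a n * \<bar>t - (real n + 1/2)\<bar>" using a2[of n] that by (intro mult_mono) auto
    then show ?thesis by (simp add: spike_def)
  qed
  define p where "p = (\<lambda>t. \<Sum>n<nat \<lceil>t\<rceil>. u n t)"
  have cp: "continuous_on UNIV p" unfolding p_def
    by (rule locally_finite_sum_continuous)
       (auto simp: u_def intro!: far, auto simp: spike_def intro!: continuous_intros)
  have p_eq: "p t = u n t" if t: "real n \<le> t" "t \<le> real n + 1" for n t
  proof (cases "t = real n")
    case True
    have "u j t = 0" if "j < nat \<lceil>t\<rceil>" for j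
      using that True unfolding u_def by (simp add: far abs_if)
    moreover have "u n t = 0" using True by (simp add: u_def far)
    ultimately show ?thesis by (simp add: p_def)
  next
    case False
    then have "nat \<lceil>t\<rceil> = Suc n" using t by (simp add: ceiling_eq_iff nat_eq_iff)
    moreover have "u j t = 0" if "j < n" for j
      using that t unfolding u_def by (simp add: far abs_if)
    ultimately show ?thesis by (simp add: p_def)
  qed
  have s01: "0 \<le> spike (a n) d t" "spike (a n) d t \<le> 1" for n d t
    using a2[of n] by (auto simp: spike_def)
  have p1: "\<bar>p t\<bar> \<le> 1" if "t \<ge> 0" for t
    using p_eq[of "nat \<lfloor>t\<rfloor>" t] s01[of "nat \<lfloor>t\<rfloor>" _ t] that by (simp add: u_def abs_mult power_abs)
  define g where "g = (\<lambda>t. \<Gamma> t * p t)"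
  have cg: "continuous_on {0..} g" unfolding g_def
    by (intro continuous_intros cG continuous_on_subset[OF cp]) auto
  have g_le: "\<bar>g t\<bar> \<le> \<Gamma> t" if "t \<ge> 0" for t
    using mult_left_mono[OF p1[OF that], of "\<Gamma> t"] G[OF that] by (simp add: g_def abs_mult)
  have g_half: "g (real n + 1/2) = (-1) ^ n * \<Gamma> (real n + 1/2)" for n
    using p_eq[of n "real n + 1/2"] by (simp add: g_def u_def spike_def)
  define W where "W = (\<lambda>t. integral {0..t} (\<lambda>s. \<bar>g s\<bar> * K s))"
  have cgK: "continuous_on {0..} (\<lambda>s. \<bar>g s\<bar> * K s)" by (intro continuous_intros cg cK)
  have mW: "mono W" unfolding W_def using cgK K by (intro mono_integral_from_0) auto
  have step: "integral {real n..real n + 1} (\<lambda>s. \<bar>g s\<bar> * K s) \<le> (1/2) ^ n" for n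
  proof -
    have "integral {real n..real n + 1} (\<lambda>s. \<bar>g s\<bar> * K s)
        = integral {real n..real n + 1} (\<lambda>s. M s * spike (a n) (real n + 1/2) s)"
    proof (rule integral_cong)
      fix s assume "s \<in> {real n..real n + 1}"
      then show "\<bar>g s\<bar> * K s = M s * spike (a n) (real n + 1/2) s"
        using p_eq[of n s] G[of s] s01 by (simp add: g_def u_def M_def abs_mult power_abs)
    qed
    also have "\<dots> \<le> 2 * c n / a n"
      using a2 M0 c by (intro spike_integral_le continuous_on_subset[OF cM]) auto
    also have "\<dots> \<le> (1/2) ^ n"
      using a2[of n] by (simp add: divide_simps a_def power_divide)
    finally show ?thesis .
  qed
  have WN: "W (real N) \<le> (\<Sum>n<N. (1/2) ^ n)" for N
  proof (induction N)
    case (Suc N)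
    have "W (real (Suc N)) = W (real N) + integral {real N..real N + 1} (\<lambda>s. \<bar>g s\<bar> * K s)"
      unfolding W_def
      by (subst Henstock_Kurzweil_Integration.integral_combine)
         (auto intro!: integrable_continuous_real continuous_on_subset[OF cgK] simp: add.commute)
    with Suc step[of N] show ?case by simp
  qed (simp add: W_def)
  have "W t \<le> 2" for t
  proof -
    have "W t \<le> W (real (nat \<lceil>t\<rceil>))" by (rule monoD[OF mW]) linarith
    also have "\<dots> \<le> (\<Sum>n<nat \<lceil>t\<rceil>. (1/2) ^ n)" by (rule WN)
    also have "\<dots> \<le> (\<Sum>n. (1/2) ^ n)" by (rule sum_le_suminf) (auto simp: summable_geometric)
    also have "\<dots> = (2::real)" by (subst suminf_geometric) auto
    finally show ?thesis .
  qed
  with cg g_le g_half show ?thesis unfolding W_def by blast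
qed

section \<open>The function F and its inverse\<close>

text \<open>This is the part of the hypotheses that \<open>f\<close> and its reflection \<open>\<lambda>u. - f (- u)\<close> share. Regular
  variation is left out: it is assumed for \<open>f\<close> alone.\<close>

locale restoring_force =
  fixes h :: "real \<Rightarrow> real"
  assumes cont: "continuous_on {0<..} h"
    and pos: "x > 0 \<Longrightarrow> h x > 0"
    and sublinear: "((\<lambda>x. h x / x) \<longlongrightarrow> 0) (at_right 0)"
begin

lemma nonzero: "x > 0 \<Longrightarrow> h x \<noteq> 0"
  using pos[of x] by simp

lemma F_of_has_derivative:
  assumes "x > 0"
  shows "(F_of h has_real_derivative (- 1 / h x)) (at x)"
proof -
  (* a compact interval in the open half-line containing both x and the base point 1 *)
  define a b where "a = min x 1 / 2" and "b = max x 1 + 1"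
  have ab: "0 < a" "a < x" "x < b" "a \<le> 1" "1 \<le> b"
    using assms by (auto simp: a_def b_def)
  have "continuous_on {a..b} (\<lambda>u. 1 / h u)"
    using ab nonzero by (intro continuous_intros continuous_on_subset[OF cont]) force+
  then have "((\<lambda>u. LBINT y=1..u. 1 / h y) has_vector_derivative (1 / h x)) (at x within {a..b})"
    using interval_integral_FTC2[of a 1 b "\<lambda>u. 1 / h u" x] ab by (simp add: one_ereal_def)
  then have "((\<lambda>u. LBINT y=1..u. 1 / h y) has_real_derivative (1 / h x)) (at x)"
    using ab by (simp add: has_real_derivative_iff_has_vector_derivative at_within_Icc_at)
  then have "((\<lambda>u. - (LBINT y=1..u. 1 / h y)) has_real_derivative - (1 / h x)) (at x)"
    by (rule DERIV_minus)
  moreover have "F_of h = (\<lambda>u. - (LBINT y=1..u. 1 / h y))"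
    by (rule ext, unfold F_of_def, rule interval_integral_endpoints_reverse)
  ultimately show ?thesis by simp
qed

lemma F_of_strict_antimono:
  assumes "0 < x" "x < y"
  shows "F_of h y < F_of h x"
proof (rule DERIV_neg_imp_decreasing[OF assms(2)])
  fix u assume "x \<le> u"
  then show "\<exists>d. (F_of h has_real_derivative d) (at u) \<and> d < 0"
    using assms(1) F_of_has_derivative[of u] pos[of u] by (intro exI[of _ "- 1 / h u"]) auto
qed

lemma F_of_less_iff: "0 < x \<Longrightarrow> 0 < y \<Longrightarrow> F_of h x < F_of h y \<longleftrightarrow> y < x"
  by (metis F_of_strict_antimono less_asym' linorder_neqE_linordered_idom)

lemma F_of_le_iff: "0 < x \<Longrightarrow> 0 < y \<Longrightarrow> F_of h x \<le> F_of h y \<longleftrightarrow> y \<le> x"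
  using F_of_less_iff[of y x] by (meson not_le)

lemma F_of_isCont: "x > 0 \<Longrightarrow> isCont (F_of h) x"
  using F_of_has_derivative by (rule DERIV_isCont)

lemma F_of_continuous_on: "continuous_on {0<..} (F_of h)"
  by (intro continuous_at_imp_continuous_on) (auto intro: F_of_isCont)

lemma F_of_one: "F_of h 1 = 0"
  using interval_integral_endpoints_reverse[of "ereal 1" "ereal 1" "\<lambda>u. 1 / h u"]
  by (simp add: F_of_def one_ereal_def)

text \<open>Near zero \<open>h u < u\<close>, so \<^term>\<open>F_of h\<close> grows at least as fast as \<open>- ln\<close>.\<close>

lemma F_of_at_top: "filterlim (F_of h) at_top (at_right 0)"
proof -
  have "eventually (\<lambda>x. h x / x < 1) (at_right 0)"
    using order_tendstoD(2)[OF sublinear, of 1] by simp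
  then obtain d where d: "d > 0" "\<And>x. 0 < x \<Longrightarrow> x < d \<Longrightarrow> h x / x < 1"
    by (auto simp: eventually_at_right_field)
  define c where "c = d / 2"
  have c: "c > 0" "\<And>x. 0 < x \<Longrightarrow> x \<le> c \<Longrightarrow> h x < x"
    using d by (auto simp: c_def divide_simps)
  have low: "F_of h c + ln c - ln x \<le> F_of h x" if "0 < x" "x < c" for x
  proof -
    have "F_of h c + ln c \<le> F_of h x + ln x"
    proof (rule DERIV_nonpos_imp_nonincreasing[where f = "\<lambda>x. F_of h x + ln x"])
      fix u assume u: "x \<le> u" "u \<le> c"
      then have "u > 0" using that by auto
      have "((\<lambda>x. F_of h x + ln x) has_real_derivative (- 1 / h u + 1 / u)) (at u)"
        using \<open>u > 0\<close> F_of_has_derivative by (auto intro!: derivative_eq_intros)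
      moreover have "- 1 / h u + 1 / u \<le> 0"
        using c(2)[of u] u \<open>u > 0\<close> pos[of u] by (simp add: divide_simps)
      ultimately show "\<exists>y. ((\<lambda>x. F_of h x + ln x) has_real_derivative y) (at u) \<and> y \<le> 0"
        by blast
    qed (use that in simp)
    then show ?thesis by simp
  qed
  have "filterlim (\<lambda>x::real. F_of h c + ln c - ln x) at_top (at_right 0)"
    unfolding diff_conv_add_uminus
    by (intro filterlim_tendsto_add_at_top[OF tendsto_const] filterlim_uminus_at_top[THEN iffD2])
       (simp add: ln_at_0)
  then show ?thesis
    by (rule filterlim_at_top_mono)
       (use c low in \<open>auto simp: eventually_at_right_field intro!: exI[of _ c]\<close>)
qed

lemma F_of_inj: "inj_on (F_of h) {0<..}"
  by (rule inj_onI) (metis F_of_less_iff greaterThan_iff less_irrefl linorder_neqE_linordered_idom)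

lemma F_of_surj:
  assumes t: "t \<ge> 0"
  shows "\<exists>x>0. F_of h x = t"
proof -
  have "eventually (\<lambda>x. F_of h x \<ge> t \<and> x < 1) (at_right 0)"
    using F_of_at_top eventually_at_right_less[of 0]
    by (auto simp: filterlim_at_top eventually_conj_iff eventually_at_right_field intro!: exI[of _ 1])
  then obtain a where a: "0 < a" "a < 1" "F_of h a \<ge> t"
    unfolding eventually_at_right_field by (metis field_lbound_gt_zero zero_less_one)
  have "\<exists>x. a \<le> x \<and> x \<le> 1 \<and> F_of h x = t"
    using a t by (intro IVT2' continuous_on_subset[OF F_of_continuous_on]) (auto simp: F_of_one)
  then obtain x where "a \<le> x" "x \<le> 1" "F_of h x = t" by blast
  then show ?thesis using a(1) by (intro exI[of _ x]) auto
qed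

lemma
  assumes "t \<ge> 0"
  shows F_inv_pos: "F_inv h t > 0" and F_of_F_inv: "F_of h (F_inv h t) = t"
proof -
  obtain x where "x > 0" "F_of h x = t" using F_of_surj[OF assms] by blast
  then have "F_inv h t = x"
    unfolding F_inv_def by (intro the_inv_into_f_eq F_of_inj) auto
  with \<open>x > 0\<close> \<open>F_of h x = t\<close> show "F_inv h t > 0" "F_of h (F_inv h t) = t" by auto
qed

lemma F_inv_F_of: "x > 0 \<Longrightarrow> F_inv h (F_of h x) = x"
  unfolding F_inv_def by (intro the_inv_into_f_f F_of_inj) auto

lemma F_of_less_F_inv_iff: "t \<ge> 0 \<Longrightarrow> x > 0 \<Longrightarrow> F_of h x < t \<longleftrightarrow> F_inv h t < x"
  using F_of_less_iff[of x "F_inv h t"] F_inv_pos[of t] F_of_F_inv[of t] by auto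

lemma F_inv_antimono: "0 \<le> s \<Longrightarrow> s \<le> t \<Longrightarrow> F_inv h t \<le> F_inv h s"
  using F_of_le_iff[of "F_inv h s" "F_inv h t"] F_inv_pos F_of_F_inv by auto

lemma F_inv_isCont:
  assumes "t \<ge> 0"
  shows "isCont (F_inv h) t"
proof -
  have p: "F_inv h t > 0" using F_inv_pos[OF assms] .
  have "isCont (F_inv h) (F_of h (F_inv h t))"
    by (rule isCont_inverse_function[where f = "F_of h" and x = "F_inv h t" and d = "F_inv h t / 2"])
       (use p in \<open>auto simp: abs_if split: if_splits intro!: F_inv_F_of F_of_isCont\<close>)
  then show ?thesis using F_of_F_inv[OF assms] by simp
qed

lemma F_inv_tendsto_0: "filterlim (F_inv h) (at_right 0) at_top"
  unfolding filterlim_at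
proof (intro conjI)
  show "(F_inv h \<longlongrightarrow> 0) at_top"
  proof (rule order_tendstoI)
    fix a :: real assume "a < 0"
    then show "eventually (\<lambda>t. a < F_inv h t) at_top"
      using F_inv_pos by (auto intro!: eventually_at_top_linorderI[of 0] intro: less_trans)
  next
    fix a :: real assume "0 < a"
    then show "eventually (\<lambda>t. F_inv h t < a) at_top"
      using F_of_less_F_inv_iff[of _ a]
      by (intro eventually_at_top_linorderI[of "\<bar>F_of h a\<bar> + 1"]) (smt (verit))
  qed
  show "eventually (\<lambda>t. F_inv h t \<in> {0<..} \<and> F_inv h t \<noteq> 0) at_top"
    using F_inv_pos by (intro eventually_at_top_linorderI[of 0]) force
qed

section \<open>Solutions above a fast barrier\<close>

text \<open>The function \<open>F_of h (x t) - t\<close> has derivative \<open>- g t / h (x t)\<close>, whose modulus is at most the derivative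
  \<open>\<bar>g t\<bar> * K t\<close> of the weighted integral.\<close>

lemma drift_bound:
  assumes t0: "0 < a" "a \<le> b"
    and der: "\<And>t. a \<le> t \<Longrightarrow> t \<le> b \<Longrightarrow> (x has_real_derivative (- h (x t) + g t)) (at t)"
    and xpos: "\<And>t. a \<le> t \<Longrightarrow> t \<le> b \<Longrightarrow> x t > 0"
    and K: "\<And>t. a \<le> t \<Longrightarrow> t \<le> b \<Longrightarrow> 1 / h (x t) \<le> K t"
    and cg: "continuous_on {0..} g" and cK: "continuous_on {0..} K"
    and small: "integral {0..b} (\<lambda>s. \<bar>g s\<bar> * K s) - integral {0..a} (\<lambda>s. \<bar>g s\<bar> * K s) \<le> 1"
  shows "\<bar>F_of h (x b) - (F_of h (x a) + (b - a))\<bar> \<le> 1"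
proof -
  define W where "W = (\<lambda>t. integral {0..t} (\<lambda>s. \<bar>g s\<bar> * K s))"
  have cgK: "continuous_on {0..} (\<lambda>s. \<bar>g s\<bar> * K s)"
    by (intro continuous_intros cg cK)
  have W': "(W has_real_derivative (\<bar>g t\<bar> * K t)) (at t)" if "a \<le> t" for t
  proof -
    have "(W has_real_derivative (\<bar>g t\<bar> * K t)) (at t within {0..t+1})"
      unfolding W_def using that t0
      by (intro integral_has_real_derivative continuous_on_subset[OF cgK]) auto
    then show ?thesis using that t0 by (simp add: at_within_Icc_at)
  qed
  have D: "((\<lambda>t. F_of h (x t) - t) has_real_derivative (- g t / h (x t))) (at t)"
    if "a \<le> t" "t \<le> b" for t
  proof -
    have "((\<lambda>t. F_of h (x t)) has_real_derivative (- 1 / h (x t)) * (- h (x t) + g t)) (at t)"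
      by (rule DERIV_chain2[OF F_of_has_derivative[OF xpos[OF that]] der[OF that]])
    then have "((\<lambda>t. F_of h (x t) - t) has_real_derivative (- 1 / h (x t)) * (- h (x t) + g t) - 1) (at t)"
      by (intro DERIV_diff DERIV_ident)
    moreover have "(- 1 / h (x t)) * (- h (x t) + g t) - 1 = - g t / h (x t)"
      using pos[OF xpos[OF that]] by (simp add: field_simps)
    ultimately show ?thesis by simp
  qed
  have bd: "\<bar>- g t / h (x t)\<bar> \<le> \<bar>g t\<bar> * K t" if "a \<le> t" "t \<le> b" for t
  proof -
    have "\<bar>- g t / h (x t)\<bar> = \<bar>g t\<bar> * (1 / h (x t))"
      using pos[OF xpos[OF that]] by (simp add: abs_divide)
    also have "\<dots> \<le> \<bar>g t\<bar> * K t" by (intro mult_left_mono K that) auto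
    finally show ?thesis .
  qed
  have "(F_of h (x a) - a) - W a \<ge> (F_of h (x b) - b) - W b"
  proof (rule DERIV_nonpos_imp_nonincreasing[OF t0(2)])
    fix t assume t: "a \<le> t" "t \<le> b"
    show "\<exists>y. ((\<lambda>t. F_of h (x t) - t - W t) has_real_derivative y) (at t) \<and> y \<le> 0"
      using DERIV_diff[OF D[OF t] W'[OF t(1)]] bd[OF t] by (intro exI conjI) (assumption, linarith)
  qed
  moreover have "(F_of h (x a) - a) + W a \<le> (F_of h (x b) - b) + W b"
  proof (rule DERIV_nonneg_imp_nondecreasing[OF t0(2)])
    fix t assume t: "a \<le> t" "t \<le> b"
    show "\<exists>y. ((\<lambda>t. F_of h (x t) - t + W t) has_real_derivative y) (at t) \<and> y \<ge> 0"
      using DERIV_add[OF D[OF t] W'[OF t(1)]] bd[OF t] by (intro exI conjI) (assumption, linarith)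
  qed
  ultimately show ?thesis using small unfolding W_def abs_le_iff by linarith
qed

text \<open>A continuity argument with the barrier \<open>F_inv h (t\<^sup>2 + 1)\<close>. Until the solution first meets it, the
  weight \<open>K\<close> dominates \<open>1 / h (x t)\<close>, so by \<open>drift_bound\<close> the quantity \<open>F_of h (x t)\<close> has grown by at most
  \<open>t - a + 1\<close> from a value below \<open>a\<^sup>2\<close>. On the barrier it would have to be \<open>t\<^sup>2 + 1\<close>, which is larger.
  The gap between \<open>a\<^sup>2\<close> in the initial condition and \<open>a\<^sup>2 + 1\<close> on the barrier pays for the drift.\<close>

lemma persistence:
  assumes a: "1 \<le> a"
    and der: "\<And>t. a \<le> t \<Longrightarrow> (x has_real_derivative (- h (x t) + g t)) (at t)"
    and start: "F_inv h (a\<^sup>2) < x a"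
    and upper: "\<And>t. a \<le> t \<Longrightarrow> x t \<le> t"
    and K: "\<And>t u. a \<le> t \<Longrightarrow> F_inv h (t\<^sup>2 + 1) \<le> u \<Longrightarrow> u \<le> t \<Longrightarrow> 1 / h u \<le> K t"
    and cg: "continuous_on {0..} g" and cK: "continuous_on {0..} K"
    and small: "\<And>t. a \<le> t \<Longrightarrow>
      integral {0..t} (\<lambda>s. \<bar>g s\<bar> * K s) - integral {0..a} (\<lambda>s. \<bar>g s\<bar> * K s) \<le> 1"
    and t: "a \<le> t"
  shows "0 < x t \<and> \<bar>F_of h (x t) - (F_of h (x a) + (t - a))\<bar> \<le> 1"
proof -
  define m where "m = (\<lambda>t. F_inv h (t\<^sup>2 + 1))"
  have m_pos: "m t > 0" for t unfolding m_def by (rule F_inv_pos) simp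
  have m_cont: "isCont m t" for t
    unfolding m_def by (rule isCont_o2[OF _ F_inv_isCont]) (auto intro!: continuous_intros)
  have x_cont: "isCont x t" if "a \<le> t" for t using DERIV_isCont[OF der[OF that]] .
  have start_pos: "0 < x a" using start F_inv_pos[of "a\<^sup>2"] by simp
  have Fstart: "F_of h (x a) < a\<^sup>2"
    using start start_pos by (simp add: F_of_less_F_inv_iff)
  have m_start: "m a < x a"
    using start F_inv_antimono[of "a\<^sup>2" "a\<^sup>2 + 1"] unfolding m_def by simp
  have est: "\<bar>F_of h (x b) - (F_of h (x a) + (b - a))\<bar> \<le> 1"
    if b: "a \<le> b" and above: "\<And>s. a \<le> s \<Longrightarrow> s \<le> b \<Longrightarrow> m s \<le> x s" for b
  proof (rule drift_bound[OF _ b _ _ _ cg cK small[OF b]])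
    show "0 < a" using a by simp
    show "0 < x s" if "a \<le> s" "s \<le> b" for s
      using above[OF that] m_pos[of s] by linarith
    show "1 / h (x s) \<le> K s" if "a \<le> s" "s \<le> b" for s
      using above[OF that] upper[OF that(1)] K[OF that(1)] unfolding m_def by blast
  qed (use der in auto)
  have above: "m s < x s" if "a \<le> s" for s
  proof (rule ccontr)
    assume "\<not> m s < x s"
    have cmx: "continuous_on {a..b} (\<lambda>t. x t - m t)" for b
      by (intro continuous_at_imp_continuous_on ballI) (auto intro!: continuous_intros x_cont m_cont)
    have zero: "\<exists>z. a \<le> z \<and> z \<le> b \<and> x z - m z = 0" if "a \<le> b" "x b \<le> m b" for b
      using that m_start by (intro IVT2' cmx) auto
    (* the earliest meeting with the barrier exists because the set Z of meetings is compact *)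
    define Z where "Z = {a..s} \<inter> (\<lambda>t. x t - m t) -` {0}"
    have "Z \<noteq> {}" using zero[of s] \<open>\<not> m s < x s\<close> \<open>a \<le> s\<close> by (auto simp: Z_def)
    moreover have "closed Z" unfolding Z_def
      by (intro continuous_closed_preimage cmx) auto
    moreover have "bounded Z"
      unfolding Z_def by (rule bounded_subset[of "{a..s}"]) auto
    ultimately obtain z where z: "z \<in> Z" "\<And>y. y \<in> Z \<Longrightarrow> z \<le> y"
      using compact_attains_inf[of Z] unfolding compact_eq_bounded_closed by blast
    have az: "a \<le> z" and zs: "z \<le> s" and xz: "x z = m z" using z(1) by (auto simp: Z_def)
    have "m y \<le> x y" if y: "a \<le> y" "y \<le> z" for y
    proof (rule ccontr)
      assume "\<not> m y \<le> x y"
      then obtain w where w: "a \<le> w" "w \<le> y" "x w - m w = 0" using zero[OF y(1)] by auto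
      then have "w \<in> Z" using y zs by (auto simp: Z_def)
      then have "w = y" using z(2) w y by force
      then show False using w \<open>\<not> m y \<le> x y\<close> by simp
    qed
    then have "\<bar>F_of h (x z) - (F_of h (x a) + (z - a))\<bar> \<le> 1" by (intro est az)
    then have "F_of h (x z) < a\<^sup>2 + (z - a) + 1" using Fstart by (simp add: abs_le_iff)
    also have "\<dots> \<le> z\<^sup>2 + 1"
    proof -
      have "0 \<le> (z - a) * (z + a - 1)" using a az by (intro mult_nonneg_nonneg) auto
      then show ?thesis by (simp add: power2_eq_square algebra_simps)
    qed
    finally show False unfolding xz m_def by (simp add: F_of_F_inv)
  qed
  show ?thesis
    using est[OF t] above m_pos[of t] above[OF t] less_imp_le by (meson less_trans)
qed

text \<open>For \<open>s\<close> in a unit interval, the values between the barrier and \<open>s\<close> stay in one compact subset of the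
  open half-line. This makes a weight as in \<open>persistence\<close> available.\<close>

lemma reciprocal_bounded_above_barrier:
  "\<exists>c. \<forall>s\<in>{real n..real n + 1}. \<forall>u. F_inv h (s\<^sup>2 + 1) \<le> u \<and> u \<le> s \<longrightarrow> 1 / h u \<le> c"
proof -
  define l where "l = F_inv h ((real n + 1)\<^sup>2 + 1)"
  have l: "l > 0" unfolding l_def by (rule F_inv_pos) simp
  have "compact ((\<lambda>u. 1 / h u) ` {l..real n + 1})"
    using l nonzero
    by (intro compact_continuous_image continuous_intros continuous_on_subset[OF cont]) force+
  then obtain B where B: "\<forall>y\<in>(\<lambda>u. 1 / h u) ` {l..real n + 1}. norm y \<le> B"
    using compact_imp_bounded bounded_iff by metis
  have "1 / h u \<le> B" if "s \<in> {real n..real n + 1}" "F_inv h (s\<^sup>2 + 1) \<le> u" "u \<le> s" for s u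
  proof -
    have "l \<le> F_inv h (s\<^sup>2 + 1)"
      unfolding l_def using that(1) by (intro F_inv_antimono) (auto intro!: power_mono)
    then have "u \<in> {l..real n + 1}" using that by auto
    then have "norm (1 / h u) \<le> B" using B by blast
    then show ?thesis by (metis abs_ge_self order_trans real_norm_def)
  qed
  then show ?thesis by blast
qed

section \<open>Asymptotic inversion by regular variation\<close>

lemma filterlim_at_right_0_if_F_of_at_top:
  assumes pos_y: "eventually (\<lambda>t. y t > 0) G" and "filterlim (\<lambda>t. F_of h (y t)) at_top G"
  shows "filterlim y (at_right 0) G"
  unfolding filterlim_at
proof (intro conjI)
  show "eventually (\<lambda>t. y t \<in> {0<..} \<and> y t \<noteq> 0) G" using pos_y by eventually_elim auto
  show "(y \<longlongrightarrow> 0) G"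
  proof (rule order_tendstoI)
    fix a :: real assume "a < 0"
    then show "eventually (\<lambda>t. a < y t) G" using pos_y by (auto elim: eventually_mono)
  next
    fix a :: real assume "0 < a"
    have "eventually (\<lambda>t. F_of h a < F_of h (y t)) G"
      using assms(2) by (simp add: filterlim_at_top_dense)
    with pos_y show "eventually (\<lambda>t. y t < a) G"
      by eventually_elim (use \<open>0 < a\<close> F_of_less_iff in blast)
  qed
qed

lemma F_of_ratio:
  assumes k: "restoring_force k" and lim: "((\<lambda>x. h x / k x) \<longlongrightarrow> 1) (at_right 0)"
  shows "((\<lambda>x. F_of k x / F_of h x) \<longlongrightarrow> 1) (at_right 0)"
proof (rule lhopital_right_at_top[OF F_of_at_top])
  show "eventually (\<lambda>x. - 1 / h x \<noteq> 0) (at_right 0)"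
    using nonzero by (auto simp: eventually_at_right_field intro!: exI[of _ 1])
  show "eventually (\<lambda>x. (F_of k has_real_derivative - 1 / k x) (at x)) (at_right 0)"
    using restoring_force.F_of_has_derivative[OF k]
    by (auto simp: eventually_at_right_field intro!: exI[of _ 1])
  show "eventually (\<lambda>x. (F_of h has_real_derivative - 1 / h x) (at x)) (at_right 0)"
    using F_of_has_derivative by (auto simp: eventually_at_right_field intro!: exI[of _ 1])
  show "((\<lambda>x. (- 1 / k x) / (- 1 / h x)) \<longlongrightarrow> 1) (at_right 0)"
    using lim by (simp add: divide_divide_eq_left divide_divide_eq_right)
qed

text \<open>L'Hopital's rule: the quotient of the derivatives is \<open>l * h x / h (l * x)\<close>.\<close>

lemma F_of_regularly_varying:
  assumes rv: "RV0 \<beta> h" and l: "l > 0"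
  shows "((\<lambda>x. F_of h (l * x) / F_of h x) \<longlongrightarrow> l powr (1 - \<beta>)) (at_right 0)"
proof (rule lhopital_right_at_top[OF F_of_at_top])
  show "eventually (\<lambda>x. - 1 / h x \<noteq> 0) (at_right 0)"
    using nonzero by (auto simp: eventually_at_right_field intro!: exI[of _ 1])
  show "eventually (\<lambda>x. (F_of h has_real_derivative - 1 / h x) (at x)) (at_right 0)"
    using F_of_has_derivative by (auto simp: eventually_at_right_field intro!: exI[of _ 1])
  have "((\<lambda>x. F_of h (l * x)) has_real_derivative (- 1 / h (l * x) * l)) (at x)" if "x > 0" for x
    using that l by (intro DERIV_chain2[OF F_of_has_derivative]) (auto intro!: derivative_eq_intros)
  then show "eventually (\<lambda>x. ((\<lambda>x. F_of h (l * x)) has_real_derivative (- 1 / h (l * x) * l)) (at x))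
      (at_right 0)"
    by (auto simp: eventually_at_right_field intro!: exI[of _ 1])
  have "((\<lambda>x. l * inverse (h (l * x) / h x)) \<longlongrightarrow> l * inverse (l powr \<beta>)) (at_right 0)"
    using rv l unfolding RV0_def by (intro tendsto_intros) auto
  moreover have "l * inverse (l powr \<beta>) = l powr (1 - \<beta>)"
    using l by (simp add: powr_diff divide_inverse)
  moreover have "(\<lambda>x. l * inverse (h (l * x) / h x)) = (\<lambda>x. (- 1 / h (l * x) * l) / (- 1 / h x))"
    by (auto simp: fun_eq_iff)
  ultimately show "((\<lambda>x. (- 1 / h (l * x) * l) / (- 1 / h x)) \<longlongrightarrow> l powr (1 - \<beta>)) (at_right 0)"
    by simp
qed

lemma F_of_scaled_F_inv:
  assumes "RV0 \<beta> h" "l > 0"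
  shows "((\<lambda>t. F_of h (l * F_inv h t) / t) \<longlongrightarrow> l powr (1 - \<beta>)) at_top"
proof -
  have "((\<lambda>t. F_of h (l * F_inv h t) / F_of h (F_inv h t)) \<longlongrightarrow> l powr (1 - \<beta>)) at_top"
    by (rule filterlim_compose[OF F_of_regularly_varying[OF assms] F_inv_tendsto_0])
  then show ?thesis
    by (rule Lim_transform_eventually)
       (auto intro!: eventually_at_top_linorderI[of 0] simp: F_of_F_inv)
qed

text \<open>Compare \<open>y\<close> with a multiple \<open>l * F_inv h t\<close>. The values of \<^term>\<open>F_of h\<close> there, divided by \<open>t\<close>, tend to
  \<open>l powr (1 - \<beta>)\<close>, which is above 1 for \<open>l < 1\<close> and below 1 for \<open>l > 1\<close> since \<open>\<beta> > 1\<close>. As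
  \<^term>\<open>F_of h\<close> decreases, \<open>y\<close> lies eventually on the expected side of each multiple.\<close>

lemma asymptotic_to_F_inv:
  assumes rv: "RV0 \<beta> h" and \<beta>: "\<beta> > 1"
    and y: "eventually (\<lambda>t. y t > 0) at_top" and lim: "((\<lambda>t. F_of h (y t) / t) \<longlongrightarrow> 1) at_top"
  shows "((\<lambda>t. y t / F_inv h t) \<longlongrightarrow> 1) at_top"
proof (rule order_tendstoI)
  fix a :: real assume a: "a < 1"
  show "eventually (\<lambda>t. a < y t / F_inv h t) at_top"
  proof (cases "a > 0")
    case True
    then have "1 < a powr (1 - \<beta>)" using a \<beta> by (simp add: powr_less_mono2_neg[of "1 - \<beta>" a 1, simplified])
    then obtain c where c: "1 < c" "c < a powr (1 - \<beta>)" using dense by blast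
    have "eventually (\<lambda>t. F_of h (y t) / t < c) at_top" using order_tendstoD(2)[OF lim c(1)] .
    moreover have "eventually (\<lambda>t. c < F_of h (a * F_inv h t) / t) at_top"
      using order_tendstoD(1)[OF F_of_scaled_F_inv[OF rv True] c(2)] .
    ultimately show ?thesis using y eventually_gt_at_top[of 0]
    proof eventually_elim
      case (elim t)
      have p: "F_inv h t > 0" using elim by (intro F_inv_pos) simp
      have "F_of h (y t) / t < F_of h (a * F_inv h t) / t" using elim by linarith
      then have "F_of h (y t) < F_of h (a * F_inv h t)" using elim by (simp add: divide_less_cancel)
      then have "a * F_inv h t < y t" using elim p True by (simp add: F_of_less_iff)
      then show ?case using p by (simp add: less_divide_eq)
    qed
  next
    case False
    show ?thesis using y eventually_gt_at_top[of 0]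
    proof eventually_elim
      case (elim t)
      have "0 < y t / F_inv h t" using elim by (intro divide_pos_pos F_inv_pos) auto
      with False show ?case by simp
    qed
  qed
next
  fix b :: real assume b: "1 < b"
  then have "b powr (1 - \<beta>) < 1" using \<beta> by (simp add: powr_less_mono2_neg[of "1 - \<beta>" 1 b, simplified])
  then obtain c where c: "b powr (1 - \<beta>) < c" "c < 1" using dense by blast
  have "eventually (\<lambda>t. c < F_of h (y t) / t) at_top" using order_tendstoD(1)[OF lim c(2)] .
  moreover have "eventually (\<lambda>t. F_of h (b * F_inv h t) / t < c) at_top"
    using order_tendstoD(2)[OF F_of_scaled_F_inv[OF rv] c(1)] b by simp
  ultimately show "eventually (\<lambda>t. y t / F_inv h t < b) at_top" using y eventually_gt_at_top[of 0]
  proof eventually_elim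
    case (elim t)
    have p: "F_inv h t > 0" using elim by (intro F_inv_pos) simp
    have "F_of h (b * F_inv h t) / t < F_of h (y t) / t" using elim by linarith
    then have "F_of h (b * F_inv h t) < F_of h (y t)" using elim by (simp add: divide_less_cancel)
    then have "y t < b * F_inv h t" using elim p b by (simp add: F_of_less_iff)
    then show ?case using p by (simp add: divide_less_eq)
  qed
qed

text \<open>The same comparison with the multiples of \<^term>\<open>F_inv h\<close>: along each of them
  \<open>F_of h (l * F_inv h t) / t\<close> stays bounded.\<close>

lemma negligible_to_F_inv:
  assumes rv: "RV0 \<beta> h"
    and y: "eventually (\<lambda>t. y t > 0) at_top" and lim: "filterlim (\<lambda>t. F_of h (y t) / t) at_top at_top"
  shows "((\<lambda>t. y t / F_inv h t) \<longlongrightarrow> 0) at_top"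
proof (rule order_tendstoI)
  fix a :: real assume a: "a < 0"
  show "eventually (\<lambda>t. a < y t / F_inv h t) at_top"
    using y eventually_gt_at_top[of 0]
  proof eventually_elim
    case (elim t)
    have "0 < y t / F_inv h t" using elim by (intro divide_pos_pos F_inv_pos) auto
    with a show ?case by simp
  qed
next
  fix b :: real assume b: "0 < b"
  define c where "c = b powr (1 - \<beta>) + 1"
  have "eventually (\<lambda>t. c < F_of h (y t) / t) at_top" using lim by (simp add: filterlim_at_top_dense)
  moreover have "eventually (\<lambda>t. F_of h (b * F_inv h t) / t < c) at_top"
    using order_tendstoD(2)[OF F_of_scaled_F_inv[OF rv b], of c] by (simp add: c_def)
  ultimately show "eventually (\<lambda>t. y t / F_inv h t < b) at_top" using y eventually_gt_at_top[of 0]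
  proof eventually_elim
    case (elim t)
    have p: "F_inv h t > 0" using elim by (intro F_inv_pos) simp
    have "F_of h (b * F_inv h t) / t < F_of h (y t) / t" using elim by linarith
    then have "F_of h (b * F_inv h t) < F_of h (y t)" using elim by (simp add: divide_less_cancel)
    then have "y t < b * F_inv h t" using elim p b by (simp add: F_of_less_iff)
    then show ?case using p by (simp add: divide_less_eq)
  qed
qed

end

text \<open>The solution (or its negative) is driven by \<open>k\<close>, while its size is to be compared with \<^term>\<open>F_inv h\<close>.
  Below, \<open>h\<close> is \<open>f\<close>, and \<open>k\<close> is either \<open>f\<close> or its reflection.\<close>

locale comparable_forces = restoring_force h + k: restoring_force k
  for h k :: "real \<Rightarrow> real" and \<beta> :: real +
  assumes rv: "RV0 \<beta> h" and \<beta>: "\<beta> > 1"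
    and ratio: "((\<lambda>x. k x / h x) \<longlongrightarrow> 1) (at_right 0)"
begin

lemma F_of_ratio_along:
  assumes "eventually (\<lambda>t. y t > 0) G" and "filterlim (\<lambda>t. F_of k (y t)) at_top G"
  shows "((\<lambda>t. F_of h (y t) / F_of k (y t)) \<longlongrightarrow> 1) G"
  by (rule filterlim_compose[OF k.F_of_ratio[OF restoring_force_axioms ratio]])
     (rule k.filterlim_at_right_0_if_F_of_at_top[OF assms])

lemma tracks_F_inv:
  assumes y: "eventually (\<lambda>t. y t > 0) at_top" and lim: "((\<lambda>t. F_of k (y t) / t) \<longlongrightarrow> 1) at_top"
  shows "((\<lambda>t. y t / F_inv h t) \<longlongrightarrow> 1) at_top"
proof (rule asymptotic_to_F_inv[OF rv \<beta> y])
  have "filterlim (\<lambda>t. F_of k (y t) / t * t) at_top at_top"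
    by (rule filterlim_tendsto_pos_mult_at_top[OF lim _ filterlim_ident]) simp
  then have top: "filterlim (\<lambda>t. F_of k (y t)) at_top at_top"
    by (rule filterlim_at_top_mono) (rule eventually_at_top_linorderI[of 1], simp)
  have "((\<lambda>t. F_of h (y t) / F_of k (y t) * (F_of k (y t) / t)) \<longlongrightarrow> 1 * 1) at_top"
    by (intro tendsto_mult lim F_of_ratio_along y top)
  moreover have "eventually (\<lambda>t. F_of h (y t) / F_of k (y t) * (F_of k (y t) / t) = F_of h (y t) / t) at_top"
    using top[unfolded filterlim_at_top_dense, rule_format, of 0] by eventually_elim simp
  ultimately show "((\<lambda>t. F_of h (y t) / t) \<longlongrightarrow> 1) at_top"
    using Lim_transform_eventually by fastforce
qed

lemma barrier_negligible: "((\<lambda>t. F_inv k (t\<^sup>2) / F_inv h t) \<longlongrightarrow> 0) at_top"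
proof (rule negligible_to_F_inv[OF rv])
  define y where "y = (\<lambda>t. F_inv k (t\<^sup>2))"
  have y: "eventually (\<lambda>t. y t > 0) at_top" unfolding y_def by (simp add: k.F_inv_pos)
  then show "eventually (\<lambda>t. F_inv k (t\<^sup>2) > 0) at_top" unfolding y_def .
  have Fy: "F_of k (y t) = t\<^sup>2" for t unfolding y_def by (simp add: k.F_of_F_inv)
  have top: "filterlim (\<lambda>t. F_of k (y t)) at_top at_top"
    unfolding Fy by (intro filterlim_pow_at_top filterlim_ident) simp
  have "filterlim (\<lambda>t. F_of h (y t) / F_of k (y t) * t) at_top at_top"
    by (rule filterlim_tendsto_pos_mult_at_top[OF F_of_ratio_along[OF y top] _ filterlim_ident]) simp
  moreover have "F_of h (y t) / F_of k (y t) * t = F_of h (y t) / t" for t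
    unfolding Fy by (cases "t = 0") (auto simp: power2_eq_square)
  ultimately show "filterlim (\<lambda>t. F_of h (F_inv k (t\<^sup>2)) / t) at_top at_top"
    by (simp add: y_def)
qed

lemma solution_tracks_F_inv:
  assumes a: "1 \<le> a"
    and der: "\<And>t. a \<le> t \<Longrightarrow> (x has_real_derivative (- k (x t) + g t)) (at t)"
    and start: "F_inv k (a\<^sup>2) < x a"
    and upper: "\<And>t. a \<le> t \<Longrightarrow> x t \<le> t"
    and K: "\<And>t u. a \<le> t \<Longrightarrow> F_inv k (t\<^sup>2 + 1) \<le> u \<Longrightarrow> u \<le> t \<Longrightarrow> 1 / k u \<le> K t"
    and cg: "continuous_on {0..} g" and cK: "continuous_on {0..} K"
    and small: "\<And>t. a \<le> t \<Longrightarrow>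
      integral {0..t} (\<lambda>s. \<bar>g s\<bar> * K s) - integral {0..a} (\<lambda>s. \<bar>g s\<bar> * K s) \<le> 1"
  shows "((\<lambda>t. x t / F_inv h t) \<longlongrightarrow> 1) at_top"
proof (rule tracks_F_inv)
  note p = k.persistence[OF a der start upper K cg cK small]
  show "eventually (\<lambda>t. x t > 0) at_top"
    using p by (intro eventually_at_top_linorderI[of a]) auto
  define c where "c = F_of k (x a) - a"
  have lim: "((\<lambda>t. 1 + d / t) \<longlongrightarrow> 1) at_top" for d :: real
    using tendsto_add[OF tendsto_const tendsto_divide_0[OF tendsto_const filterlim_at_top_imp_at_infinity[OF filterlim_ident]]]
    by simp
  show "((\<lambda>t. F_of k (x t) / t) \<longlongrightarrow> 1) at_top"
  proof (rule tendsto_sandwich[OF _ _ lim lim])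
    show "eventually (\<lambda>t. 1 + (c - 1) / t \<le> F_of k (x t) / t) at_top"
    proof (rule eventually_at_top_linorderI[of a])
      fix t assume "a \<le> t"
      then have "t + (c - 1) \<le> F_of k (x t)" "t > 0"
        using p[of t] a by (auto simp: c_def abs_le_iff)
      then show "1 + (c - 1) / t \<le> F_of k (x t) / t" by (simp add: divide_simps add.commute)
    qed
    show "eventually (\<lambda>t. F_of k (x t) / t \<le> 1 + (c + 1) / t) at_top"
    proof (rule eventually_at_top_linorderI[of a])
      fix t assume "a \<le> t"
      then have "t + (c + 1) \<ge> F_of k (x t)" "t > 0"
        using p[of t] a by (auto simp: c_def abs_le_iff)
      then show "F_of k (x t) / t \<le> 1 + (c + 1) / t" by (simp add: divide_simps add.commute)
    qed
  qed
qed

end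

section \<open>The perturbed equation\<close>

text \<open>The restoring term can only decrease \<open>\<bar>x\<bar>\<close>, so \<open>\<bar>x\<bar>\<close> grows by at most the integral of \<open>\<bar>g\<bar>\<close>. The smooth
  function \<open>sqrt (1 + x\<^sup>2)\<close> replaces \<open>\<bar>x\<bar>\<close>, which need not be differentiable at the zeros of \<open>x\<close>.\<close>

lemma solution_bounded:
  fixes k g x :: "real \<Rightarrow> real"
  assumes sol: "is_solution k g \<xi> x" and sign: "\<And>u. u * k u \<ge> 0"
    and cg: "continuous_on {0..} g"
    and bdd: "\<And>t. integral {0..t} (\<lambda>s. \<bar>g s\<bar>) \<le> C" and t: "t \<ge> 0"
  shows "\<bar>x t\<bar> \<le> sqrt (1 + \<xi>\<^sup>2) + C"
proof -
  have cx: "continuous_on {0..} x" and x0: "x 0 = \<xi>"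
    and x': "\<And>t. t > 0 \<Longrightarrow> (x has_real_derivative (- k (x t) + g t)) (at t)"
    using sol unfolding is_solution_def by auto
  define A where "A = (\<lambda>t. integral {0..t} (\<lambda>s. \<bar>g s\<bar>))"
  have cag: "continuous_on {0..} (\<lambda>s. \<bar>g s\<bar>)" by (intro continuous_intros cg)
  have "sqrt (1 + (x 0)\<^sup>2) - A 0 \<ge> sqrt (1 + (x t)\<^sup>2) - A t"
  proof (rule DERIV_nonpos_imp_decreasing_open[OF t])
    fix s assume s: "0 < s" "s < t"
    have "(A has_real_derivative \<bar>g s\<bar>) (at s within {0..t})"
      unfolding A_def using s by (intro integral_has_real_derivative continuous_on_subset[OF cag]) auto
    then have A': "(A has_real_derivative \<bar>g s\<bar>) (at s)" using s by (simp add: at_within_Icc_at)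
    let ?r = "sqrt (1 + (x s)\<^sup>2)"
    have r: "?r > 0" "\<bar>x s\<bar> \<le> ?r" "1 + (x s)\<^sup>2 > 0"
      by (auto simp: add_pos_nonneg intro: real_le_rsqrt)
    have "((\<lambda>s. sqrt (1 + (x s)\<^sup>2) - A s) has_real_derivative
        (x s * (- k (x s) + g s) / ?r - \<bar>g s\<bar>)) (at s)"
      using r by (auto intro!: derivative_eq_intros x'[OF s(1)] A' simp: field_simps)
    moreover have "x s * (- k (x s) + g s) / ?r - \<bar>g s\<bar> \<le> 0"
    proof -
      have "x s * (- k (x s) + g s) \<le> x s * g s" using sign[of "x s"] by (simp add: algebra_simps)
      also have "\<dots> \<le> \<bar>x s\<bar> * \<bar>g s\<bar>" by (metis abs_ge_self abs_mult)
      also have "\<dots> \<le> \<bar>g s\<bar> * ?r" using r by (simp add: mult.commute mult_left_mono)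
      finally show ?thesis using r by (simp add: divide_le_eq)
    qed
    ultimately show "\<exists>y. ((\<lambda>s. sqrt (1 + (x s)\<^sup>2) - A s) has_real_derivative y) (at s) \<and> y \<le> 0"
      by blast
  next
    show "continuous_on {0..t} (\<lambda>s. sqrt (1 + (x s)\<^sup>2) - A s)"
      unfolding A_def
      by (intro continuous_intros continuous_on_subset[OF cx] indefinite_integral_continuous_1
          integrable_continuous_real continuous_on_subset[OF cag]) auto
  qed
  moreover have "\<bar>x t\<bar> \<le> sqrt (1 + (x t)\<^sup>2)" by (rule real_le_rsqrt) simp
  ultimately show ?thesis using bdd[of t] by (simp add: A_def x0)
qed

text \<open>For odd \<open>\<phi>\<close>, the quotient \<open>- f (- x) / f x\<close> is that of \<open>f / \<phi>\<close> at \<open>- x\<close> and at \<open>x\<close>.\<close>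

lemma reflected_ratio:
  fixes f \<phi> :: "real \<Rightarrow> real"
  assumes odd: "\<And>x. \<phi> (- x) = - \<phi> x" and lim: "((\<lambda>x. f x / \<phi> x) \<longlongrightarrow> 1) (at 0)"
  shows "((\<lambda>x. - f (- x) / f x) \<longlongrightarrow> 1) (at_right 0)"
proof -
  have R: "((\<lambda>x. f x / \<phi> x) \<longlongrightarrow> 1) (at_right 0)" and L: "((\<lambda>x. f x / \<phi> x) \<longlongrightarrow> 1) (at_left 0)"
    using lim by (auto simp: filterlim_at_split)
  have L': "((\<lambda>x. f (- x) / \<phi> (- x)) \<longlongrightarrow> 1) (at_right 0)"
    using L by (simp add: filterlim_at_left_to_right)
  have "((\<lambda>x. (f (- x) / \<phi> (- x)) / (f x / \<phi> x)) \<longlongrightarrow> 1 / 1) (at_right 0)"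
    by (intro tendsto_divide L' R) simp
  moreover have "eventually (\<lambda>x. (f (- x) / \<phi> (- x)) / (f x / \<phi> x) = - f (- x) / f x) (at_right 0)"
    using order_tendstoD(1)[OF R, of 0, simplified] by eventually_elim (auto simp: odd)
  ultimately show ?thesis using Lim_transform_eventually by fastforce
qed

theorem theorem16:
  fixes f \<phi> \<Gamma> :: "real \<Rightarrow> real" and \<beta> :: real
  assumes "continuous_on UNIV f"
    and "f 0 = 0"
    and "\<And>x. x \<noteq> 0 \<Longrightarrow> x * f x > 0"
    and "\<And>x. \<phi> (- x) = - \<phi> x"
    and "((\<lambda>x. f x / \<phi> x) \<longlongrightarrow> 1) (at 0)"
    and "RV0 \<beta> f"
    and "\<beta> > 1"
    and "((\<lambda>x. f x / x) \<longlongrightarrow> 0) (at_right 0)"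
    and "continuous_on {0..} \<Gamma>"
    and "\<And>t. t \<ge> 0 \<Longrightarrow> \<Gamma> t > 0"
    and "filterlim \<Gamma> at_top at_top"
  shows "\<exists>g :: real \<Rightarrow> real.
           continuous_on {0..} g \<and>
           changes_sign_infinitely_often g \<and>
           has_improper_integral g \<and>
           ((\<lambda>t. tail_integral g t / F_inv f t) \<longlongrightarrow> 0) at_top \<and>
           Limsup at_top (\<lambda>t. ereal (\<bar>g t\<bar> / \<Gamma> t)) = 1 \<and>
           (\<forall>\<xi> x. is_solution f g \<xi> x \<longrightarrow>
              (\<exists>l \<in> {-1, 0, 1}. ((\<lambda>t. x t / F_inv f t) \<longlongrightarrow> l) at_top))"
proof -
  note f_cont = assms(1) and f_sign = assms(3) and \<Gamma>_pos = assms(10)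
  define k where "k = (\<lambda>u. - f (- u))"
  have f_pos: "f u > 0" and k_pos: "k u > 0" if "u > 0" for u
    using f_sign[of u] f_sign[of "-u"] that by (auto simp: zero_less_mult_iff mult_less_0_iff k_def)
  have ratio: "((\<lambda>x. k x / f x) \<longlongrightarrow> 1) (at_right 0)"
    unfolding k_def by (rule reflected_ratio[OF assms(4,5)])
  have "((\<lambda>x. k x / f x * (f x / x)) \<longlongrightarrow> 1 * 0) (at_right 0)"
    by (intro tendsto_mult ratio assms(8))
  moreover have "eventually (\<lambda>x. k x / f x * (f x / x) = k x / x) (at_right 0)"
    using eventually_at_right_less[of 0] by eventually_elim (use f_pos in force)
  ultimately have k_sublinear: "((\<lambda>x. k x / x) \<longlongrightarrow> 0) (at_right 0)"
    using Lim_transform_eventually by fastforce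
  have k_cont: "continuous_on UNIV k"
    unfolding k_def by (intro continuous_intros continuous_on_compose2[OF f_cont]) auto
  interpret F: restoring_force f
    using f_pos assms(8) by unfold_locales (auto intro: continuous_on_subset[OF f_cont])
  interpret K: restoring_force k
    using k_pos k_sublinear by unfold_locales (auto intro: continuous_on_subset[OF k_cont])
  interpret ff: comparable_forces f f \<beta>
  proof unfold_locales
    have "eventually (\<lambda>x. 1 = f x / f x) (at_right 0)"
      using eventually_at_right_less[of 0] by eventually_elim (use f_pos in force)
    then show "((\<lambda>x. f x / f x) \<longlongrightarrow> 1) (at_right 0)"
      by (rule Lim_transform_eventually[OF tendsto_const])
  qed (use assms in auto)
  interpret fk: comparable_forces f k \<beta>
    by unfold_locales (use assms ratio in auto)

  (* The weight M is at least 1 to make g itself integrable, at least 1 / F_inv f to control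
     the tail of g, and dominates the reciprocals above both barriers for persistence. *)
  define P where "P = (\<lambda>t v. v = 1 \<or> v = 1 / F_inv f t \<or>
      (\<exists>u. F_inv f (t\<^sup>2 + 1) \<le> u \<and> u \<le> t \<and> v = 1 / f u) \<or>
      (\<exists>u. F_inv k (t\<^sup>2 + 1) \<le> u \<and> u \<le> t \<and> v = 1 / k u))"
  have "\<exists>c. \<forall>t\<in>{real n..real n + 1}. \<forall>v. P t v \<longrightarrow> v \<le> c" for n
  proof -
    obtain c d where c: "\<And>t u. t \<in> {real n..real n + 1} \<Longrightarrow> F_inv f (t\<^sup>2 + 1) \<le> u \<Longrightarrow> u \<le> t \<Longrightarrow> 1 / f u \<le> c"
      and d: "\<And>t u. t \<in> {real n..real n + 1} \<Longrightarrow> F_inv k (t\<^sup>2 + 1) \<le> u \<Longrightarrow> u \<le> t \<Longrightarrow> 1 / k u \<le> d"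
      using F.reciprocal_bounded_above_barrier[of n] K.reciprocal_bounded_above_barrier[of n] by metis
    have "1 / F_inv f t \<le> 1 / F_inv f (real n + 1)" if "t \<in> {real n..real n + 1}" for t
      using that by (intro divide_left_mono F.F_inv_antimono mult_pos_pos F.F_inv_pos) auto
    then show ?thesis
      using c d unfolding P_def
      by (intro exI[of _ "max (max c d) (max 1 (1 / F_inv f (real n + 1)))"]) (force simp: le_max_iff_disj)
  qed
  from continuous_majorant[OF this]
  obtain M where M_cont': "continuous_on UNIV M" and M: "\<And>t v. t \<ge> 0 \<Longrightarrow> P t v \<Longrightarrow> v \<le> M t"
    by metis
  have M_cont: "continuous_on {0..} M" by (rule continuous_on_subset[OF M_cont']) simp
  have M1: "M t \<ge> 1" and M_inv: "M t \<ge> 1 / F_inv f t" if "t \<ge> 0" for t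
    using M[OF that] unfolding P_def by blast+
  have M_f: "1 / f u \<le> M t" if "t \<ge> 0" "F_inv f (t\<^sup>2 + 1) \<le> u" "u \<le> t" for t u
    using M[OF that(1)] that unfolding P_def by blast
  have M_k: "1 / k u \<le> M t" if "t \<ge> 0" "F_inv k (t\<^sup>2 + 1) \<le> u" "u \<le> t" for t u
    using M[OF that(1)] that unfolding P_def by blast

  have "\<exists>g. continuous_on {0..} g \<and> (\<forall>t\<ge>0. \<bar>g t\<bar> \<le> \<Gamma> t) \<and>
    (\<forall>n::nat. g (real n + 1/2) = (-1) ^ n * \<Gamma> (real n + 1/2)) \<and>
    (\<forall>t. integral {0..t} (\<lambda>s. \<bar>g s\<bar> * M s) \<le> 2)"
    using M1 by (intro alternating_spikes assms(9) \<Gamma>_pos M_cont) force+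
  then obtain g where g_cont: "continuous_on {0..} g" and g_le: "\<And>t. t \<ge> 0 \<Longrightarrow> \<bar>g t\<bar> \<le> \<Gamma> t"
    and g_peak: "\<And>n::nat. g (real n + 1/2) = (-1) ^ n * \<Gamma> (real n + 1/2)"
    and g_int: "\<And>t. integral {0..t} (\<lambda>s. \<bar>g s\<bar> * M s) \<le> 2"
    by blast
  define W where "W = (\<lambda>t. integral {0..t} (\<lambda>s. \<bar>g s\<bar> * M s))"
  have gM_cont: "continuous_on {0..} (\<lambda>s. \<bar>g s\<bar> * M s)" by (intro continuous_intros g_cont M_cont)
  have "mono W" unfolding W_def using M1 by (intro mono_integral_from_0 gM_cont) force
  then obtain L where L: "(W \<longlongrightarrow> L) at_top" "\<And>t. W t \<le> L"
    using bounded_mono_tendsto_at_top[of W 2] g_int unfolding W_def by blast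
  have g_abs: "integral {0..t} (\<lambda>s. \<bar>g s\<bar>) \<le> 2" for t
  proof -
    have "integral {0..t} (\<lambda>s. \<bar>g s\<bar>) \<le> W t"
      unfolding W_def
    proof (rule integral_le)
      show "(\<lambda>s. \<bar>g s\<bar>) integrable_on {0..t}" "(\<lambda>s. \<bar>g s\<bar> * M s) integrable_on {0..t}"
        by (intro integrable_continuous_real continuous_on_subset[OF gM_cont]
            continuous_on_subset[OF continuous_on_rabs[OF g_cont]]; force)+
      fix s assume "s \<in> {0..t}"
      then show "\<bar>g s\<bar> \<le> \<bar>g s\<bar> * M s" using mult_left_mono[OF M1[of s], of "\<bar>g s\<bar>"] by simp
    qed
    then show ?thesis using g_int[of t] unfolding W_def by linarith
  qed

  have improper: "has_improper_integral g"
    unfolding has_improper_integral_def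
    by (rule convergent_integral_of_absolutely_bounded[OF g_cont g_abs])

  have tail: "((\<lambda>t. tail_integral g t / F_inv f t) \<longlongrightarrow> 0) at_top"
  proof (rule Lim_null_comparison)
    show "((\<lambda>t. L - W t) \<longlongrightarrow> 0) at_top"
      using tendsto_diff[OF tendsto_const L(1), of L] by simp
    show "eventually (\<lambda>t. norm (tail_integral g t / F_inv f t) \<le> L - W t) at_top"
    proof (rule eventually_at_top_linorderI)
      fix t :: real assume t: "0 \<le> t"
      have p: "F_inv f t > 0" by (rule F.F_inv_pos[OF t])
      have "\<bar>tail_integral g t\<bar> \<le> F_inv f t * (L - integral {0..t} (\<lambda>s. \<bar>g s\<bar> * M s))"
      proof (rule tail_integral_abs_le[OF g_cont gM_cont improper t])
        fix s assume s: "t \<le> s"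
        have "1 \<le> F_inv f s * M s"
          using M_inv[of s] F.F_inv_pos[of s] s t by (simp add: divide_le_eq mult.commute)
        also have "\<dots> \<le> F_inv f t * M s"
          using F.F_inv_antimono[OF t s] M1[of s] s t by (intro mult_right_mono) auto
        finally show "\<bar>g s\<bar> \<le> F_inv f t * (\<bar>g s\<bar> * M s)"
          using mult_left_mono[of 1 "F_inv f t * M s" "\<bar>g s\<bar>"] by (simp add: algebra_simps)
      qed (use p L(2) in \<open>auto simp: W_def\<close>)
      then show "norm (tail_integral g t / F_inv f t) \<le> L - W t"
        using p by (simp add: W_def abs_divide divide_le_eq mult.commute)
    qed
  qed

  have sign: "changes_sign_infinitely_often g"
    unfolding changes_sign_infinitely_often_def
  proof (intro allI impI)
    fix T :: real assume "0 \<le> T"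
    define n where "n = nat \<lceil>T\<rceil>"
    have n: "T \<le> real n" unfolding n_def by linarith
    have "g (real (2 * n) + 1/2) > 0" "g (real (2 * n + 1) + 1/2) < 0"
      unfolding g_peak using \<Gamma>_pos[of "real (2 * n) + 1/2"] \<Gamma>_pos[of "real (2 * n + 1) + 1/2"] by auto
    then show "(\<exists>s\<ge>T. g s > 0) \<and> (\<exists>t\<ge>T. g t < 0)"
      using n by (intro conjI exI[of _ "real (2 * n) + 1/2"] exI[of _ "real (2 * n + 1) + 1/2"]) auto
  qed

  have limsup: "Limsup at_top (\<lambda>t. ereal (\<bar>g t\<bar> / \<Gamma> t)) = 1"
  proof (rule antisym)
    show "Limsup at_top (\<lambda>t. ereal (\<bar>g t\<bar> / \<Gamma> t)) \<le> 1"
      using g_le \<Gamma>_pos by (intro Limsup_bounded eventually_at_top_linorderI[of 0]) (simp add: divide_le_eq)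
    show "Limsup at_top (\<lambda>t. ereal (\<bar>g t\<bar> / \<Gamma> t)) \<ge> 1"
    proof (rule Limsup_greatest)
      fix Q :: "real \<Rightarrow> bool" assume "eventually Q at_top"
      then obtain T where T: "\<And>t. t \<ge> T \<Longrightarrow> Q t" by (auto simp: eventually_at_top_linorder)
      define s where "s = real (nat \<lceil>T\<rceil>) + 1/2"
      have "Q s" by (rule T) (unfold s_def, linarith)
      moreover have "\<bar>g s\<bar> / \<Gamma> s = 1"
        using \<Gamma>_pos[of s] unfolding s_def g_peak by (simp add: abs_mult power_abs)
      ultimately show "1 \<le> (SUP t\<in>Collect Q. ereal (\<bar>g t\<bar> / \<Gamma> t))"
        by (intro SUP_upper2[of s]) auto
    qed
  qed

  have "\<exists>l \<in> {-1, 0, 1}. ((\<lambda>t. x t / F_inv f t) \<longlongrightarrow> l) at_top" if sol: "is_solution f g \<xi> x" for \<xi> x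
  proof -
    have x': "\<And>t. t > 0 \<Longrightarrow> (x has_real_derivative (- f (x t) + g t)) (at t)"
      using sol unfolding is_solution_def by auto
    have z': "((\<lambda>t. - x t) has_real_derivative (- k (- x t) + (- g t))) (at t)" if "t > 0" for t
      using DERIV_minus[OF x'[OF that]] by (simp add: k_def)
    define B where "B = sqrt (1 + \<xi>\<^sup>2) + 2"
    have f_sign': "u * f u \<ge> 0" for u using f_sign[of u] by (cases "u = 0") auto
    have x_bd: "\<bar>x t\<bar> \<le> B" if "t \<ge> 0" for t
      unfolding B_def by (rule solution_bounded[OF sol f_sign' g_cont g_abs that])
    have "eventually (\<lambda>t. L - 1 < W t) at_top" using order_tendstoD(1)[OF L(1)] by simp
    then obtain T' where T': "\<And>t. t \<ge> T' \<Longrightarrow> L - 1 < W t" by (auto simp: eventually_at_top_linorder)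
    (* After time T the remaining drift is at most 1, and solutions lie below the line x = t,
       up to which M dominates the reciprocals. *)
    define T where "T = max T' (max 1 B)"
    have small: "W t - W a \<le> 1" if "T \<le> a" for a t
      using T'[of a] L(2)[of t] that by (simp add: T_def)
    have x_le: "x t \<le> t" "- x t \<le> t" if "T \<le> t" for t
      using x_bd[of t] that by (auto simp: T_def abs_le_iff)
    consider (up) a where "T \<le> a" "F_inv f (a\<^sup>2) < x a"
      | (down) a where "T \<le> a" "F_inv k (a\<^sup>2) < - x a"
      | (mid) "\<And>t. T \<le> t \<Longrightarrow> x t \<le> F_inv f (t\<^sup>2) \<and> - F_inv k (t\<^sup>2) \<le> x t"
      by (metis linorder_not_less minus_le_iff)
    then show ?thesis
    proof cases
      case up
      have a: "1 \<le> a" using up by (simp add: T_def)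
      have "((\<lambda>t. x t / F_inv f t) \<longlongrightarrow> 1) at_top"
        by (rule ff.solution_tracks_F_inv[OF a x' up(2) x_le(1) M_f g_cont M_cont])
           (use a up small in \<open>auto simp: W_def\<close>)
      then show ?thesis by blast
    next
      case down
      have a: "1 \<le> a" using down by (simp add: T_def)
      have "((\<lambda>t. - x t / F_inv f t) \<longlongrightarrow> 1) at_top"
        by (rule fk.solution_tracks_F_inv[OF a z' down(2) x_le(2) M_k continuous_on_minus[OF g_cont] M_cont])
           (use a down small in \<open>auto simp: W_def\<close>)
      then have "((\<lambda>t. x t / F_inv f t) \<longlongrightarrow> - 1) at_top" using tendsto_minus by fastforce
      then show ?thesis by blast
    next
      case mid
      have pos: "F_inv f t > 0" if "T \<le> t" for t
        using that by (intro F.F_inv_pos) (simp add: T_def)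
      have "((\<lambda>t. x t / F_inv f t) \<longlongrightarrow> 0) at_top"
      proof (rule tendsto_sandwich)
        show "((\<lambda>t. - (F_inv k (t\<^sup>2) / F_inv f t)) \<longlongrightarrow> 0) at_top"
          using tendsto_minus[OF fk.barrier_negligible] by simp
        show "((\<lambda>t. F_inv f (t\<^sup>2) / F_inv f t) \<longlongrightarrow> 0) at_top"
          by (rule ff.barrier_negligible)
        show "eventually (\<lambda>t. - (F_inv k (t\<^sup>2) / F_inv f t) \<le> x t / F_inv f t) at_top"
        proof (rule eventually_at_top_linorderI)
          fix t assume "T \<le> t"
          then have "- F_inv k (t\<^sup>2) / F_inv f t \<le> x t / F_inv f t"
            using mid pos by (intro divide_right_mono) (auto intro: less_imp_le)
          then show "- (F_inv k (t\<^sup>2) / F_inv f t) \<le> x t / F_inv f t" by simp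
        qed
        show "eventually (\<lambda>t. x t / F_inv f t \<le> F_inv f (t\<^sup>2) / F_inv f t) at_top"
          using mid pos by (intro eventually_at_top_linorderI[of T] divide_right_mono) (auto intro: less_imp_le)
      qed
      then show ?thesis by blast
    qed
  qed
  with g_cont sign improper tail limsup show ?thesis by blast
qed

end
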